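(* The game $\langle P_n, h, g\rangle$, where $h$ is the function constantly equal to $4s-1$ and $g$ is the function constantly equal to $s$, is losing for all $n$.
   Context: Hat guessing game $\langle G, h, g\rangle$: a sage sits at each vertex $v$ of the graph $G$; an adversary puts on the head of each sage $v$ a hat whose color is chosen from $\{0,1,\dots,h(v)-1\}$; each sage sees the hat colors of his neighbours but not his own; without communication, each sage $v$ names a list of $g(v)$ colors, determined by a deterministic strategy (fixed in advance and known to the adversary) from the colors he sees. The game is winning if there is a strategy guaranteeing that for every hat assignment at least one sage's list contains his own hat color; otherwise it is losing. $P_n$ is the path on $n$ vertices, $s\ge 1$ an integer. *)

theory Defs
  imports "Graph_Theory.Pair_Digraph" "HOL-Library.FuncSet"
begin

text \<open>
  The hat guessing game \<open>\<langle>G, h, g\<rangle>\<close> on a finite simple graph \<open>G\<close> (a \<^locale>\<open>pair_graph\<close>, that is,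
  a finite loop-free digraph with a symmetric arc relation), for a hatness function \<open>h\<close> and a
  guessing function \<open>g\<close>.
\<close>

definition neighbours :: "'a pair_pre_digraph \<Rightarrow> 'a \<Rightarrow> 'a set" where
  "neighbours G v = {u. v \<rightarrow>\<^bsub>G\<^esub> u}"

definition hat_assignments :: "'a set \<Rightarrow> ('a \<Rightarrow> nat) \<Rightarrow> ('a \<Rightarrow> nat) set" where
  "hat_assignments V h = (\<Pi>\<^sub>E v\<in>V. {..<h v})"

text \<open>
  The sage at \<open>v\<close> turns what he sees, a hat assignment to his neighbours, into a list of \<open>g v\<close>
  colours. Repetitions in the list are allowed; as only membership of a colour in the list
  matters and a repeated colour may be replaced by a further one, this is no advantage over
  \<open>g v\<close> distinct colours when \<open>g v \<le> h v\<close>.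
\<close>

definition strategies ::
    "'a pair_pre_digraph \<Rightarrow> ('a \<Rightarrow> nat) \<Rightarrow> ('a \<Rightarrow> nat) \<Rightarrow> ('a \<Rightarrow> ('a \<Rightarrow> nat) \<Rightarrow> nat list) set" where
  "strategies G h g =
     (\<Pi> v\<in>pverts G. hat_assignments (neighbours G v) h \<rightarrow>
        {xs. set xs \<subseteq> {..<h v} \<and> length xs = g v})"

definition winning ::
    "'a pair_pre_digraph \<Rightarrow> ('a \<Rightarrow> nat) \<Rightarrow> ('a \<Rightarrow> nat) \<Rightarrow> bool" where
  "winning G h g \<longleftrightarrow>
     (\<exists>f\<in>strategies G h g. \<forall>c\<in>hat_assignments (pverts G) h.
        \<exists>v\<in>pverts G. c v \<in> set (f v (restrict c (neighbours G v))))"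

abbreviation losing ::
    "'a pair_pre_digraph \<Rightarrow> ('a \<Rightarrow> nat) \<Rightarrow> ('a \<Rightarrow> nat) \<Rightarrow> bool" where
  "losing G h g \<equiv> \<not> winning G h g"

definition path_graph :: "nat \<Rightarrow> nat pair_pre_digraph" where
  "path_graph n =
     \<lparr>pverts = {..<n}, parcs = {(i, j). i < n \<and> j < n \<and> (j = Suc i \<or> i = Suc j)}\<rparr>"

lemma pair_graph_path_graph: "pair_graph (path_graph n)"
proof
  show "finite (parcs (path_graph n))"
    by (rule finite_subset[of _ "{..<n} \<times> {..<n}"]) (auto simp: path_graph_def)
qed (auto simp: path_graph_def symmetric_def intro!: symI)

end

theory Submission
  imports Defs
begin

text \<open>
  Scan the path from its first vertex, calling a pair of colours of the sages \<open>k\<close> and \<open>k + 1\<close> safe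
  if it extends to an assignment in which the sages \<open>0, \<dots>, k\<close> all fail. The invariant is that
  every colour \<open>c\<close> of sage \<open>k + 1\<close> forms a safe pair with at least \<open>2s\<close> colours of sage \<open>k\<close>.
  Fix \<open>c\<close> at sage \<open>k + 2\<close>. If a colour \<open>b\<close> of sage \<open>k + 1\<close> forms no safe pair with \<open>c\<close>, then it is
  guessed for each of the at least \<open>2s\<close> colours \<open>a\<close> of sage \<open>k\<close> that are safe with \<open>b\<close>. As only
  \<open>s\<close> colours are guessed for each of the \<open>4s - 1\<close> values of \<open>a\<close>, there are at most
  \<open>s (4s - 1) / (2s) < 2s\<close> such \<open>b\<close>, which leaves at least \<open>2s\<close> safe colours.
\<close>

definition safe :: "(nat \<Rightarrow> (nat \<Rightarrow> nat) \<Rightarrow> nat set) \<Rightarrow> nat \<Rightarrow> nat \<Rightarrow> nat \<Rightarrow> nat \<Rightarrow> bool" where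
  "safe G h k b c \<longleftrightarrow>
     (\<exists>x. (\<forall>i. x i < h) \<and> x k = b \<and> x (Suc k) = c \<and> (\<forall>i\<le>k. x i \<notin> G i x))"

lemma card_complement_lessThan:
  "card {b. b < (h::nat) \<and> P b} + card {b. b < h \<and> \<not> P b} = h"
proof -
  have "card ({b. b < h \<and> P b} \<union> {b. b < h \<and> \<not> P b})
      = card {b. b < h \<and> P b} + card {b. b < h \<and> \<not> P b}"
    by (rule card_Un_disjoint) auto
  moreover have "{b. b < h \<and> P b} \<union> {b. b < h \<and> \<not> P b} = {..<h}"
    by auto
  ultimately show ?thesis
    by simp
qed

text \<open>With \<open>d\<close> in the role of \<open>2s\<close>, \<open>sh\<close> is what the
  double count needs: \<open>card W * d \<le> s * h\<close> for the set \<open>W\<close> of unsafe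
  colours forces \<open>card W < h + 1 - d\<close>, so at least \<open>d\<close> safe colours
  remain. \<open>local\<close> confines the view of sage \<open>i\<close> to the sages next to
  it.\<close>

lemma card_safe_ge:
  assumes local: "\<And>i x y. x (Suc i) = y (Suc i) \<Longrightarrow> (\<And>j. Suc j = i \<Longrightarrow> x j = y j) \<Longrightarrow> G i x = G i y"
    and fin: "\<And>i x. finite (G i x)"
    and card_G: "\<And>i x. (\<And>j. x j < h) \<Longrightarrow> card (G i x) \<le> s"
    and sh: "s * h < d * (h + 1 - d)" and dh: "d \<le> h" and c: "c < h"
  shows "d \<le> card {b. b < h \<and> safe G h k b c}"
  using c
proof (induction k arbitrary: c)
  case 0
  \<comment> \<open>Sage \<open>0\<close> sees only \<open>c\<close>, so at most \<open>s\<close>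
    colours are lost; weakening \<open>d\<close> to \<open>h\<close> in \<open>sh\<close> and
    cancelling shows that \<open>d\<close> remain.\<close>
  have "s * h < h * (h + 1 - d)"
    using sh dh by (meson less_le_trans mult_le_mono1)
  then have "s < h + 1 - d"
    by (simp add: mult.commute)
  then have "s + d \<le> h"
    using dh by simp
  moreover have "safe G h 0 b c" if "b < h" "b \<notin> G 0 (\<lambda>_. c)" for b
  proof -
    let ?x = "\<lambda>j::nat. if j = 0 then b else c"
    have "G 0 ?x = G 0 (\<lambda>_. c)"
      by (rule local) auto
    with that 0 show ?thesis
      unfolding safe_def by (intro exI[of _ ?x]) auto
  qed
  then have "{b. b < h \<and> \<not> safe G h 0 b c} \<subseteq> G 0 (\<lambda>_. c)"
    by auto
  then have "card {b. b < h \<and> \<not> safe G h 0 b c} \<le> s"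
    using card_mono[OF fin] card_G[of "\<lambda>_. c" 0] 0 by (meson order_trans)
  ultimately show ?case
    using card_complement_lessThan[of h "\<lambda>b. safe G h 0 b c"] by linarith
next
  case (Suc k)
  define W where "W = {b. b < h \<and> \<not> safe G h (Suc k) b c}"
  \<comment> \<open>Only the colours \<open>a\<close> at \<open>k\<close> and \<open>c\<close> at
    \<open>k + 2\<close> are seen; \<open>c\<close> elsewhere is a filler below
    \<open>h\<close>.\<close>
  define T where "T a = G (Suc k) (\<lambda>j. if j = k then a else c)" for a
  have guessed: "b \<in> T a" if "b \<in> W" "safe G h k a b" for a b
  proof (rule ccontr)
    assume "b \<notin> T a"
    from that(2) obtain x where x: "\<And>i. x i < h" "x k = a" "x (Suc k) = b"
        "\<And>i. i \<le> k \<Longrightarrow> x i \<notin> G i x"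
      unfolding safe_def by blast
    \<comment> \<open>Recolouring sage \<open>k + 2\<close> is invisible to the sages up to
      \<open>k\<close>.\<close>
    define y where "y = x(Suc (Suc k) := c)"
    have "G (Suc k) y = T a"
      unfolding T_def by (rule local) (auto simp: y_def x)
    moreover have "G i y = G i x" if "i \<le> k" for i
      using that by (intro local) (auto simp: y_def)
    ultimately have "\<forall>i\<le>Suc k. y i \<notin> G i y"
      using x \<open>b \<notin> T a\<close> by (auto simp: le_Suc_eq y_def)
    then have "safe G h (Suc k) b c"
      unfolding safe_def using x Suc.prems by (intro exI[of _ y]) (auto simp: y_def)
    with that(1) show False
      by (simp add: W_def)
  qed
  have finW: "finite W"
    by (simp add: W_def)
  have finT: "finite (T a)" for a
    by (simp add: T_def fin)
  have "card W * d \<le> (\<Sum>b\<in>W. card {a. a < h \<and> safe G h k a b})"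
    using sum_bounded_below[of W d] Suc.IH by (simp add: W_def)
  also have "\<dots> = card (SIGMA b:W. {a. a < h \<and> safe G h k a b})"
    using finW by simp
  \<comment> \<open>By \<open>guessed\<close>, swapping embeds the safe pairs over \<open>W\<close>
    into the guessed pairs.\<close>
  also have "\<dots> \<le> card (SIGMA a:{..<h}. T a)"
    by (rule card_inj_on_le[where f = prod.swap])
       (use guessed finT in \<open>auto simp: inj_on_def\<close>)
  also have "\<dots> = (\<Sum>a<h. card (T a))"
    using finT by simp
  also have "\<dots> \<le> (\<Sum>a<h. s)"
    unfolding T_def using Suc.prems by (intro sum_mono card_G) auto
  also have "\<dots> < d * (h + 1 - d)"
    using sh by (simp add: mult.commute)
  finally have "card W < h + 1 - d"
    by (simp add: mult.commute)
  then show ?case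
    using card_complement_lessThan[of h "\<lambda>b. safe G h (Suc k) b c"] dh
    unfolding W_def by linarith
qed

lemma losing_path_graph:
  assumes sh: "s * h < d * (h + 1 - d)" and dh: "d \<le> h"
  shows "losing (path_graph n) (\<lambda>_. h) (\<lambda>_. s)"
proof
  have pverts: "pverts (path_graph n) = {..<n}"
    by (simp add: path_graph_def)
  assume "winning (path_graph n) (\<lambda>_. h) (\<lambda>_. s)"
  then obtain f where f: "f \<in> strategies (path_graph n) (\<lambda>_. h) (\<lambda>_. s)"
    and win: "\<And>x. x \<in> hat_assignments {..<n} (\<lambda>_. h) \<Longrightarrow>
      \<exists>v<n. x v \<in> set (f v (restrict x (neighbours (path_graph n) v)))"
    unfolding winning_def by (fastforce simp: pverts)
  have nb: "neighbours (path_graph n) v = {u. v < n \<and> u < n \<and> (u = Suc v \<or> v = Suc u)}" for v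
    by (auto simp: neighbours_def path_graph_def)
  \<comment> \<open>The path is prolonged by sages that guess nothing and so always fail.\<close>
  define G where
    "G i x = (if i < n then set (f i (restrict x (neighbours (path_graph n) i))) else {})"
    for i and x :: "nat \<Rightarrow> nat"
  have "0 < d"
    using sh by (cases d) auto
  then have "0 < h"
    using dh by simp
  \<comment> \<open>Index \<open>n\<close> lies just past the last sage, which also covers
    \<open>n = 0\<close>; colour \<open>0\<close> is a dummy.\<close>
  have "d \<le> card {b. b < h \<and> safe G h n b 0}"
  proof (rule card_safe_ge[OF _ _ _ sh dh \<open>0 < h\<close>])
    fix i and x y :: "nat \<Rightarrow> nat"
    assume "x (Suc i) = y (Suc i)" "\<And>j. Suc j = i \<Longrightarrow> x j = y j"
    then have "restrict x (neighbours (path_graph n) i) = restrict y (neighbours (path_graph n) i)"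
      unfolding nb by (intro restrict_ext) auto
    then show "G i x = G i y"
      by (simp add: G_def)
  next
    fix i and x :: "nat \<Rightarrow> nat"
    show "finite (G i x)"
      by (simp add: G_def)
    assume x: "\<And>j. x j < h"
    show "card (G i x) \<le> s"
    proof (cases "i < n")
      case True
      have "restrict x (neighbours (path_graph n) i)
          \<in> hat_assignments (neighbours (path_graph n) i) (\<lambda>_. h)"
        using x by (auto simp: hat_assignments_def)
      moreover have "i \<in> pverts (path_graph n)"
        using True by (simp add: pverts)
      ultimately have "length (f i (restrict x (neighbours (path_graph n) i))) = s"
        using f unfolding strategies_def by fast
      then show ?thesis
        using card_length[of "f i (restrict x (neighbours (path_graph n) i))"]
        by (simp add: G_def)
    qed (simp add: G_def)
  qed
  with \<open>0 < d\<close> have "{b. b < h \<and> safe G h n b 0} \<noteq> {}"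
    by (metis card.empty not_less)
  then obtain x where x: "\<And>i. x i < h" "\<And>i. i \<le> n \<Longrightarrow> x i \<notin> G i x"
    unfolding safe_def by blast
  have "restrict x {..<n} \<in> hat_assignments {..<n} (\<lambda>_. h)"
    using x(1) by (auto simp: hat_assignments_def)
  from win[OF this] obtain v where v: "v < n"
    "x v \<in> set (f v (restrict (restrict x {..<n}) (neighbours (path_graph n) v)))"
    by auto
  moreover have "{..<n} \<inter> neighbours (path_graph n) v = neighbours (path_graph n) v"
    by (auto simp: nb)
  ultimately have "x v \<in> G v x"
    by (simp add: G_def)
  with x(2)[of v] v(1) show False
    by simp
qed

theorem theorem3p3:
  fixes s n :: nat
  assumes "s \<ge> 1"
  shows "losing (path_graph n) (\<lambda>_. 4 * s - 1) (\<lambda>_. s)"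
proof (rule losing_path_graph)
  \<comment> \<open>For \<open>d = 2s\<close> this reads \<open>4s^2 - s < 4s^2\<close>.\<close>
  show "s * (4 * s - 1) < 2 * s * (4 * s - 1 + 1 - 2 * s)"
    using assms by (cases s) (auto simp: algebra_simps)
  show "2 * s \<le> 4 * s - 1"
    using assms by simp
qed

end
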